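(* Assume that the kernel $K_\lambda(t)=\partial_\lambda\log w_{\lambda,\theta}(t)$ does not depend on $\theta$, and that the kernels $t\mapsto K_\lambda(t)$ and $t\mapsto L_\theta(t)=\partial_\theta\log w_{\lambda,\theta}(t)$ are monotone on $J$ with monotonicity signs $\varepsilon_K$ and $\varepsilon_L$ (the same for all $(\lambda,\theta)\in\Lambda\times\Theta$). Then for all $\xi_1\le\xi_2$ in $\Lambda$ and $\eta_1\le\eta_2$ in $\Theta$, $$\varepsilon_K\,\varepsilon_L\,\bigl\{\Phi(\xi_2,\eta_2)\Phi(\xi_1,\eta_1)-\Phi(\xi_1,\eta_2)\Phi(\xi_2,\eta_1)\bigr\}\ge 0 .$$ Thus $\Phi$ is log-supermodular in $(\lambda,\theta)$ when $\varepsilon_K\varepsilon_L=+1$, and log-submodular when $\varepsilon_K\varepsilon_L=-1$. Moreover, the inequality is strict for $\xi_1<\xi_2$, $\eta_1<\eta_2$ whenever the strict inequality $\varepsilon_K\varepsilon_L\operatorname{Cov}(K_\lambda(X),L_\theta(X))>0$, with $X\sim P_\theta$, holds for all $(\lambda,\theta)\in[\xi_1,\xi_2]\times[\eta_1,\eta_2]$.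
   Context: Setting. $\Lambda,\Theta\subseteq\mathbb R$ are intervals, and $J$ is either an interval of $\mathbb R$, equipped with Lebesgue measure $\mu$, or a subset of $\mathbb N_0=\{0,1,2,\dots\}$, equipped with counting measure $\mu$. For $(\lambda,\theta)\in\Lambda\times\Theta$, $w_{\lambda,\theta}:J\to(0,\infty)$ is a (measurable) positive weight function, and $\Phi(\lambda,\theta)=\int_J w_{\lambda,\theta}(t)\,d\mu(t)$ is assumed finite and positive for all $(\lambda,\theta)$. For given $\lambda$, $P_\theta$ is the probability law on $J$ with density $w_{\lambda,\theta}/\Phi(\lambda,\theta)$ with respect to $\mu$. Standing regularity assumptions. (1) For each parameter $r\in\{\lambda,\theta\}$, with the other parameter fixed, $r\mapsto\log w_{\lambda,\theta}(t)$ is $C^1$ for every $t\in J$, and for every compact interval $B$ in the domain of $r$ there is $m_B\in L^1(J,\mu)$ with $\sup_{r\in B}|\partial_r w_{\lambda,\theta}(t)|\le m_B(t)$ for $\mu$-a.e. $t\in J$. (2) The map $(\lambda,\theta)\mapsto\log w_{\lambda,\theta}(t)$ is $C^2$ on $\Lambda\times\Theta$ for every $t\in J$, and for every compact rectangle $B\subseteq\Lambda\times\Theta$ there is $m_B\in L^1(J,\mu)$ with $\sup_{(\lambda,\theta)\in B}|\partial_\lambda\partial_\theta w_{\lambda,\theta}(t)|\le m_B(t)$ for $\mu$-a.e. $t\in J$. Monotonicity sign. For a real function $f$ on $J$: $\varepsilon_f=+1$ if $f$ is nondecreasing, $\varepsilon_f=-1$ if $f$ is nonincreasing, $\varepsilon_f=0$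 otherwise. $\Phi$ is log-supermodular (log-submodular) if $\Phi(\xi_2,\eta_2)\Phi(\xi_1,\eta_1)\ge$ ($\le$) $\Phi(\xi_1,\eta_2)\Phi(\xi_2,\eta_1)$ for all $\xi_1\le\xi_2$, $\eta_1\le\eta_2$. *)

theory Defs
  imports "HOL-Analysis.Analysis"
begin

section \<open>Derivatives on intervals\<close>

text \<open>
  Derivatives are taken within the interval, hence one-sided at an endpoint that belongs to it.
  They are uniquely determined on intervals with more than one point.
\<close>

definition deriv_within :: "real set \<Rightarrow> (real \<Rightarrow> real) \<Rightarrow> real \<Rightarrow> real" where
  "deriv_within S f x = vector_derivative f (at x within S)"

definition C1_on :: "real set \<Rightarrow> (real \<Rightarrow> real) \<Rightarrow> bool" where
  "C1_on S f \<longleftrightarrow> f differentiable_on S \<and> continuous_on S (deriv_within S f)"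

definition partial1 :: "real set \<Rightarrow> (real \<Rightarrow> real \<Rightarrow> real) \<Rightarrow> real \<Rightarrow> real \<Rightarrow> real" where
  "partial1 S f x y = deriv_within S (\<lambda>u. f u y) x"

definition partial2 :: "real set \<Rightarrow> (real \<Rightarrow> real \<Rightarrow> real) \<Rightarrow> real \<Rightarrow> real \<Rightarrow> real" where
  "partial2 T f x y = deriv_within T (\<lambda>v. f x v) y"

definition C1_rect :: "real set \<Rightarrow> real set \<Rightarrow> (real \<Rightarrow> real \<Rightarrow> real) \<Rightarrow> bool" where
  "C1_rect S T f \<longleftrightarrow>
     (\<forall>y\<in>T. (\<lambda>u. f u y) differentiable_on S) \<and>
     (\<forall>x\<in>S. (\<lambda>v. f x v) differentiable_on T) \<and>
     continuous_on (S \<times> T) (\<lambda>(x, y). partial1 S f x y) \<and>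
     continuous_on (S \<times> T) (\<lambda>(x, y). partial2 T f x y)"

definition C2_rect :: "real set \<Rightarrow> real set \<Rightarrow> (real \<Rightarrow> real \<Rightarrow> real) \<Rightarrow> bool" where
  "C2_rect S T f \<longleftrightarrow>
     C1_rect S T f \<and> C1_rect S T (partial1 S f) \<and> C1_rect S T (partial2 T f)"

section \<open>Weight families\<close>

text \<open>
  The discrete case takes \<open>J\<close> as a set of reals contained in the natural numbers, so that both
  cases share one type.
\<close>

definition base_measure :: "real set \<Rightarrow> real measure \<Rightarrow> bool" where
  "base_measure J \<mu> \<longleftrightarrow>
     (is_interval J \<and> \<mu> = lebesgue_on J) \<or> (J \<subseteq> \<nat> \<and> \<mu> = count_space J)"

text \<open>\<open>w x y t\<close> is the weight at the point \<open>t\<close> for the parameters \<open>\<lambda> = x\<close> and \<open>\<theta> = y\<close>.\<close>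

definition Phi :: "real measure \<Rightarrow> (real \<Rightarrow> real \<Rightarrow> real \<Rightarrow> real) \<Rightarrow> real \<Rightarrow> real \<Rightarrow> real" where
  "Phi \<mu> w x y = integral\<^sup>L \<mu> (w x y)"

definition law ::
  "real measure \<Rightarrow> (real \<Rightarrow> real \<Rightarrow> real \<Rightarrow> real) \<Rightarrow> real \<Rightarrow> real \<Rightarrow> real measure" where
  "law \<mu> w x y = density \<mu> (\<lambda>t. ennreal (w x y t / Phi \<mu> w x y))"

definition kernelK ::
  "real set \<Rightarrow> (real \<Rightarrow> real \<Rightarrow> real \<Rightarrow> real) \<Rightarrow> real \<Rightarrow> real \<Rightarrow> real \<Rightarrow> real" where
  "kernelK Lam w x y t = partial1 Lam (\<lambda>u v. ln (w u v t)) x y"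

text \<open>
  The first parameter is kept as an argument of \<open>\<partial>\<^sub>\<theta> log w\<close>, although that derivative is
  independent of \<open>\<lambda>\<close> as soon as \<open>\<partial>\<^sub>\<lambda> log w\<close> is independent of \<open>\<theta>\<close>.
\<close>

definition kernelL ::
  "real set \<Rightarrow> (real \<Rightarrow> real \<Rightarrow> real \<Rightarrow> real) \<Rightarrow> real \<Rightarrow> real \<Rightarrow> real \<Rightarrow> real" where
  "kernelL Tht w x y t = partial2 Tht (\<lambda>u v. ln (w u v t)) x y"

definition covariance :: "'a measure \<Rightarrow> ('a \<Rightarrow> real) \<Rightarrow> ('a \<Rightarrow> real) \<Rightarrow> real" where
  "covariance M X Y =
     integral\<^sup>L M (\<lambda>t. (X t - integral\<^sup>L M X) * (Y t - integral\<^sup>L M Y))"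

locale weight_family =
  fixes Lam Tht J :: "real set"
    and \<mu> :: "real measure"
    and w :: "real \<Rightarrow> real \<Rightarrow> real \<Rightarrow> real"
  assumes interval_Lam: "is_interval Lam"
    and interval_Tht: "is_interval Tht"
    and base: "base_measure J \<mu>"
    and w_measurable: "\<And>x y. x \<in> Lam \<Longrightarrow> y \<in> Tht \<Longrightarrow> w x y \<in> borel_measurable \<mu>"
    and w_pos: "\<And>x y t. x \<in> Lam \<Longrightarrow> y \<in> Tht \<Longrightarrow> t \<in> J \<Longrightarrow> 0 < w x y t"
    and w_integrable: "\<And>x y. x \<in> Lam \<Longrightarrow> y \<in> Tht \<Longrightarrow> integrable \<mu> (w x y)"
    and Phi_pos: "\<And>x y. x \<in> Lam \<Longrightarrow> y \<in> Tht \<Longrightarrow> 0 < Phi \<mu> w x y"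

text \<open>A bound on a supremum over \<open>B\<close> is stated pointwise for all parameters in \<open>B\<close>.\<close>

locale regular_weight_family = weight_family +
  assumes C1_Lam: "\<And>y t. y \<in> Tht \<Longrightarrow> t \<in> J \<Longrightarrow> C1_on Lam (\<lambda>x. ln (w x y t))"
    and dominated_Lam:
      "\<And>y a b. y \<in> Tht \<Longrightarrow> a \<le> b \<Longrightarrow> {a..b} \<subseteq> Lam \<Longrightarrow>
         \<exists>m. integrable \<mu> m \<and>
             (AE t in \<mu>. \<forall>x\<in>{a..b}. \<bar>partial1 Lam (\<lambda>u v. w u v t) x y\<bar> \<le> m t)"
    and C1_Tht: "\<And>x t. x \<in> Lam \<Longrightarrow> t \<in> J \<Longrightarrow> C1_on Tht (\<lambda>y. ln (w x y t))"
    and dominated_Tht: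
      "\<And>x c d. x \<in> Lam \<Longrightarrow> c \<le> d \<Longrightarrow> {c..d} \<subseteq> Tht \<Longrightarrow>
         \<exists>m. integrable \<mu> m \<and>
             (AE t in \<mu>. \<forall>y\<in>{c..d}. \<bar>partial2 Tht (\<lambda>u v. w u v t) x y\<bar> \<le> m t)"
    and C2_Lam_Tht: "\<And>t. t \<in> J \<Longrightarrow> C2_rect Lam Tht (\<lambda>x y. ln (w x y t))"
    and dominated_Lam_Tht:
      "\<And>a b c d. a \<le> b \<Longrightarrow> c \<le> d \<Longrightarrow> {a..b} \<subseteq> Lam \<Longrightarrow> {c..d} \<subseteq> Tht \<Longrightarrow>
         \<exists>m. integrable \<mu> m \<and>
             (AE t in \<mu>. \<forall>x\<in>{a..b}. \<forall>y\<in>{c..d}.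
                \<bar>partial1 Lam (partial2 Tht (\<lambda>u v. w u v t)) x y\<bar> \<le> m t)"

section \<open>Monotonicity signs and log-supermodularity\<close>

text \<open>
  A relation rather than a function, because a constant function is both nondecreasing and
  nonincreasing: it has both signs \<open>1\<close> and \<open>-1\<close>, so a family of nonincreasing kernels has the
  common sign \<open>-1\<close> even if some of its members are constant.
\<close>

definition mono_sign :: "real set \<Rightarrow> (real \<Rightarrow> real) \<Rightarrow> real \<Rightarrow> bool" where
  "mono_sign J f \<epsilon> \<longleftrightarrow>
     (\<epsilon> = 1 \<and> mono_on J f) \<or>
     (\<epsilon> = -1 \<and> antimono_on J f) \<or>
     (\<epsilon> = 0 \<and> \<not> mono_on J f \<and> \<not> antimono_on J f)"

definition log_supermodular_on ::
  "real set \<Rightarrow> real set \<Rightarrow> (real \<Rightarrow> real \<Rightarrow> real) \<Rightarrow> bool" where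
  "log_supermodular_on S T F \<longleftrightarrow>
     (\<forall>x1\<in>S. \<forall>x2\<in>S. \<forall>y1\<in>T. \<forall>y2\<in>T. x1 \<le> x2 \<longrightarrow> y1 \<le> y2 \<longrightarrow>
        F x2 y2 * F x1 y1 \<ge> F x1 y2 * F x2 y1)"

definition log_submodular_on ::
  "real set \<Rightarrow> real set \<Rightarrow> (real \<Rightarrow> real \<Rightarrow> real) \<Rightarrow> bool" where
  "log_submodular_on S T F \<longleftrightarrow>
     (\<forall>x1\<in>S. \<forall>x2\<in>S. \<forall>y1\<in>T. \<forall>y2\<in>T. x1 \<le> x2 \<longrightarrow> y1 \<le> y2 \<longrightarrow>
        F x2 y2 * F x1 y1 \<le> F x1 y2 * F x2 y1)"

end

theory Submission
  imports Defs "HOL-Probability.Probability_Measure"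
begin

text \<open>
  The difference of products of \<open>Phi\<close> is, up to a positive factor, the covariance of two monotone
  functions.  Since \<open>\<partial>\<^sub>\<lambda> log w\<close> is independent of \<open>\<theta>\<close>, the ratio \<open>r = w \<xi>2 \<eta> / w \<xi>1 \<eta>\<close> is the same for every \<open>\<eta>\<close>, so with
  \<open>s = w \<xi>1 \<eta>2 / w \<xi>1 \<eta>1\<close> the fourth weight is \<open>w \<xi>2 \<eta>2 = r s w \<xi>1 \<eta>1\<close>.  Dividing by
  \<open>(Phi \<xi>1 \<eta>1)\<^sup>2\<close> turns the difference of products of \<open>Phi\<close> into the covariance of \<open>r\<close> and \<open>s\<close>
  under the law \<open>Q\<close> at \<open>(\<xi>1, \<eta>1)\<close> (\<open>Phi_difference_eq_covariance\<close>).  The functions \<open>r\<close> and \<open>s\<close>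
  inherit the monotonicity signs of the kernels, because increments of \<open>log w\<close> in a parameter are
  governed by the sign of its derivative (\<open>signed_ratio_le\<close>).  Chebyshev's association inequality
  (\<open>covariance_nonneg\<close>) then gives the weak inequality; its source is the identity
  \<open>2 Cov(f, g) = \<integral>\<integral> (f t - f u) (g t - g u) dQ(t) dQ(u)\<close>.

  Strictness comes from the covariance of the kernels at the corner \<open>(\<xi>1, \<eta>1)\<close>, where the law is
  again \<open>Q\<close>.  If two points are separated there by both kernels, then they are separated by both \<open>r\<close>
  and \<open>s\<close>.  So if the covariance of \<open>r\<close> and \<open>s\<close> vanished, the double integrand would vanish almost
  everywhere for \<open>r, s\<close>, hence for the kernels, and their covariance would vanish too
  (\<open>covariance_pos\<close>).
\<close>

section \<open>Chebyshev's association inequality\<close>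

context prob_space
begin

lemma covariance_eq:
  fixes f g :: "'a \<Rightarrow> real"
  assumes "integrable M f" "integrable M g" "integrable M (\<lambda>t. f t * g t)"
  shows "covariance M f g = expectation (\<lambda>t. f t * g t) - expectation f * expectation g"
proof -
  have "(\<lambda>t. (f t - expectation f) * (g t - expectation g)) =
    (\<lambda>t. f t * g t - expectation g * f t - expectation f * g t + expectation f * expectation g)"
    by (auto simp: algebra_simps)
  then show ?thesis
    using assms by (simp add: covariance_def prob_space)
qed

text \<open>
  Expanding the product leaves an affine combination of \<open>f\<close>, \<open>g\<close> and \<open>f g\<close> in each variable, so
  both integrals can be evaluated term by term.
\<close>

lemma integral_increment_products:
  fixes f g :: "'a \<Rightarrow> real"
  assumes f: "integrable M f" and g: "integrable M g" and fg: "integrable M (\<lambda>t. f t * g t)"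
  shows integrable_increment_product: "integrable M (\<lambda>t. (f t - f u) * (g t - g u))"
    and integrable_inner: "integrable M (\<lambda>u. \<integral>t. (f t - f u) * (g t - g u) \<partial>M)"
    and integral_inner: "(\<integral>u. (\<integral>t. (f t - f u) * (g t - g u) \<partial>M) \<partial>M) = 2 * covariance M f g"
proof -
  have expand: "(\<lambda>t. (f t - f u) * (g t - g u)) =
      (\<lambda>t. f t * g t - g u * f t - f u * g t + f u * g u)" for u
    by (auto simp: algebra_simps)
  show "integrable M (\<lambda>t. (f t - f u) * (g t - g u))"
    unfolding expand using assms by simp
  have inner: "(\<lambda>u. \<integral>t. (f t - f u) * (g t - g u) \<partial>M) =
      (\<lambda>u. expectation (\<lambda>t. f t * g t) - g u * expectation f - f u * expectation g + f u * g u)"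
    unfolding expand using assms by (simp add: prob_space)
  show "integrable M (\<lambda>u. \<integral>t. (f t - f u) * (g t - g u) \<partial>M)"
    unfolding inner using assms by simp
  show "(\<integral>u. (\<integral>t. (f t - f u) * (g t - g u) \<partial>M) \<partial>M) = 2 * covariance M f g"
    unfolding inner covariance_eq[OF assms] using assms by (simp add: prob_space)
qed

lemma covariance_nonneg:
  fixes f g :: "'a \<Rightarrow> real"
  assumes "integrable M f" "integrable M g" "integrable M (\<lambda>t. f t * g t)"
    and sign: "\<And>t u. t \<in> space M \<Longrightarrow> u \<in> space M \<Longrightarrow> 0 \<le> c * ((f t - f u) * (g t - g u))"
  shows "0 \<le> c * covariance M f g"
proof -
  have "0 \<le> (\<integral>u. c * (\<integral>t. (f t - f u) * (g t - g u) \<partial>M) \<partial>M)"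
  proof (rule Bochner_Integration.integral_nonneg)
    fix u assume "u \<in> space M"
    then have "0 \<le> (\<integral>t. c * ((f t - f u) * (g t - g u)) \<partial>M)"
      using sign by (intro Bochner_Integration.integral_nonneg) auto
    then show "0 \<le> c * (\<integral>t. (f t - f u) * (g t - g u) \<partial>M)"
      by simp
  qed
  then show ?thesis
    using integral_inner[OF assms(1-3)] by simp
qed

text \<open>
  A nonnegative integrand with integral zero vanishes almost everywhere.  Applied first to the outer
  and then to the inner integral, this transports the vanishing of the covariance from \<open>f, g\<close> to any
  pair \<open>k, l\<close> that separates no more pairs of points.
\<close>

lemma covariance_pos:
  fixes f g k l :: "'a \<Rightarrow> real"
  assumes fg: "integrable M f" "integrable M g" "integrable M (\<lambda>t. f t * g t)"
    and sign: "\<And>t u. t \<in> space M \<Longrightarrow> u \<in> space M \<Longrightarrow> 0 \<le> c * ((f t - f u) * (g t - g u))"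
    and kl: "integrable M k" "integrable M l"
    and separates: "\<And>t u. t \<in> space M \<Longrightarrow> u \<in> space M \<Longrightarrow>
      (f t - f u) * (g t - g u) = 0 \<Longrightarrow> (k t - k u) * (l t - l u) = 0"
    and cov: "covariance M k l \<noteq> 0" and "c \<noteq> 0"
  shows "0 < c * covariance M f g"
proof (rule ccontr)
  assume "\<not> 0 < c * covariance M f g"
  with covariance_nonneg[OF fg sign] \<open>c \<noteq> 0\<close> have "covariance M f g = 0"
    by (auto simp: less_le)
  then have outer: "(\<integral>u. c * (\<integral>t. (f t - f u) * (g t - g u) \<partial>M) \<partial>M) = 0"
    using integral_inner[OF fg] by simp
  have inner_nonneg: "0 \<le> c * (\<integral>t. (f t - f u) * (g t - g u) \<partial>M)" if "u \<in> space M" for u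
  proof -
    have "0 \<le> (\<integral>t. c * ((f t - f u) * (g t - g u)) \<partial>M)"
      using sign that by (intro Bochner_Integration.integral_nonneg) auto
    then show ?thesis by simp
  qed
  have "AE u in M. c * (\<integral>t. (f t - f u) * (g t - g u) \<partial>M) = 0"
    using integral_nonneg_eq_0_iff_AE[of M "\<lambda>u. c * (\<integral>t. (f t - f u) * (g t - g u) \<partial>M)"]
      outer integrable_inner[OF fg] inner_nonneg by auto
  then have kl_inner: "AE u in M. (\<integral>t. (k t - k u) * (l t - l u) \<partial>M) = 0"
    using AE_space
  proof eventually_elim
    case (elim u)
    then have "AE t in M. c * ((f t - f u) * (g t - g u)) = 0"
      using integral_nonneg_eq_0_iff_AE[of M "\<lambda>t. c * ((f t - f u) * (g t - g u))"]
        integrable_increment_product[OF fg] sign by auto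
    then have "AE t in M. (k t - k u) * (l t - l u) = 0"
      using AE_space
    proof eventually_elim
      case (elim t)
      then show ?case
        using separates[of t u] \<open>u \<in> space M\<close> \<open>c \<noteq> 0\<close> by simp
    qed
    then show ?case
      by (rule integral_eq_zero_AE)
  qed
  \<comment> \<open>A Bochner integral is zero unless the integrand is integrable, so a nonzero covariance
    already yields integrability of the product.\<close>
  have "integrable M (\<lambda>t. (k t - expectation k) * (l t - expectation l))"
    using cov not_integrable_integral_eq unfolding covariance_def by blast
  then have "integrable M (\<lambda>t. (k t - expectation k) * (l t - expectation l)
      + expectation l * k t + expectation k * l t - expectation k * expectation l)"
    using kl by simp
  also have "(\<lambda>t. (k t - expectation k) * (l t - expectation l)
      + expectation l * k t + expectation k * l t - expectation k * expectation l) = (\<lambda>t. k t * l t)"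
    by (auto simp: algebra_simps)
  finally have "2 * covariance M k l = (\<integral>u. (\<integral>t. (k t - k u) * (l t - l u) \<partial>M) \<partial>M)"
    using integral_inner[OF kl] by simp
  also have "\<dots> = 0"
    using integral_eq_zero_AE[OF kl_inner] .
  finally show False
    using cov by simp
qed

end

section \<open>Increments of the logarithmic weight\<close>

lemma deriv_within_works:
  "f differentiable_on S \<Longrightarrow> x \<in> S \<Longrightarrow> (f has_real_derivative deriv_within S f x) (at x within S)"
  unfolding deriv_within_def differentiable_on_def
  by (simp add: vector_derivative_works has_real_derivative_iff_has_vector_derivative)

lemma deriv_within_eq:
  assumes S: "is_interval S" "a \<in> S" "b \<in> S" "a \<noteq> b"
    and D: "(f has_real_derivative D) (at x within S)" and x: "x \<in> S"
  shows "deriv_within S f x = D"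
proof -
  have "x islimpt S"
    using S x connected_imp_perfect[of S x] is_interval_connected_1 by blast
  then have "at x within S \<noteq> bot"
    using trivial_limit_within by blast
  then show ?thesis
    unfolding deriv_within_def
    using D vector_derivative_within[of x S f D]
    by (simp add: has_real_derivative_iff_has_vector_derivative)
qed

lemma deriv_within_weight:
  fixes W :: "real \<Rightarrow> real"
  assumes S: "is_interval S" "a \<in> S" "b \<in> S" "a \<noteq> b" and x: "x \<in> S"
    and pos: "\<And>x. x \<in> S \<Longrightarrow> 0 < W x"
    and D: "((\<lambda>x. ln (W x)) has_real_derivative k) (at x within S)"
  shows "deriv_within S W x = W x * k"
proof (rule deriv_within_eq[OF S _ x])
  have "((\<lambda>x. exp (ln (W x))) has_real_derivative W x * k) (at x within S)"
    using DERIV_chain2[OF DERIV_exp D] pos[OF x] by simp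
  then show "(W has_real_derivative W x * k) (at x within S)"
    by (rule has_field_derivative_transform_within[where d = 1]) (use x pos in auto)
qed

lemma nonneg_derivative_within_imp_le:
  fixes h :: "real \<Rightarrow> real"
  assumes S: "is_interval S" "a \<in> S" "b \<in> S" "a \<le> b"
    and D: "\<And>x. x \<in> S \<Longrightarrow> (h has_real_derivative h' x) (at x within S)"
    and nonneg: "\<And>x. x \<in> S \<Longrightarrow> 0 \<le> h' x"
  shows "h a \<le> h b"
proof (rule DERIV_nonneg_imp_increasing_open[OF \<open>a \<le> b\<close>])
  have sub: "{a..b} \<subseteq> S"
    using S by (meson atLeastAtMost_iff is_interval_1 subsetI)
  fix x assume x: "a < x" "x < b"
  then have "x \<in> S"
    using sub by (meson atLeastAtMost_iff less_imp_le subsetD)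
  have "(h has_real_derivative h' x) (at x within {a<..<b})"
  proof (rule DERIV_subset)
    show "(h has_real_derivative h' x) (at x within S)"
      using D \<open>x \<in> S\<close> .
    show "{a<..<b} \<subseteq> S"
      using sub by auto
  qed
  then have "(h has_real_derivative h' x) (at x)"
    using x by (simp add: at_within_open[of x "{a<..<b}"])
  then show "\<exists>y. (h has_real_derivative y) (at x) \<and> 0 \<le> y"
    using nonneg[OF \<open>x \<in> S\<close>] by auto
next
  have sub: "{a..b} \<subseteq> S"
    using S by (meson atLeastAtMost_iff is_interval_1 subsetI)
  show "continuous_on {a..b} h"
    using D sub by (meson DERIV_continuous continuous_on_eq_continuous_within continuous_on_subset)
qed

lemma pos_derivative_within_imp_less:
  fixes h :: "real \<Rightarrow> real"
  assumes S: "is_interval S" "a \<in> S" "b \<in> S" "a < b"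
    and D: "\<And>x. x \<in> S \<Longrightarrow> (h has_real_derivative h' x) (at x within S)"
    and nonneg: "\<And>x. x \<in> S \<Longrightarrow> 0 \<le> h' x" and pos: "0 < h' a"
  shows "h a < h b"
proof -
  obtain d where d: "0 < d" "\<And>e. 0 < e \<Longrightarrow> a + e \<in> S \<Longrightarrow> e < d \<Longrightarrow> h a < h (a + e)"
    using has_real_derivative_pos_inc_right[OF D[OF S(2)] pos] by blast
  define e where "e = min (d / 2) (b - a)"
  have e: "0 < e" "e < d" "a + e \<le> b"
    using d(1) S(4) by (auto simp: e_def)
  then have "a + e \<in> S"
    using S by (meson is_interval_1 less_add_same_cancel1 less_imp_le)
  then have "h a < h (a + e)" "h (a + e) \<le> h b"
    using d(2) e nonneg_derivative_within_imp_le[OF S(1) _ S(3) _ D nonneg] by auto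
  then show ?thesis by simp
qed

text \<open>
  The function \<open>x \<mapsto> c (ln (W x u) - ln (W x t))\<close> has derivative \<open>c (k x u - k x t)\<close>, so it increases,
  and strictly from \<open>a\<close> on if that derivative is positive at \<open>a\<close>.  Its increment compares the
  logarithms of the two ratios, hence the ratios themselves.
\<close>

lemma signed_ratio_le:
  fixes W k :: "real \<Rightarrow> 'a \<Rightarrow> real"
  assumes S: "is_interval S" "a \<in> S" "b \<in> S" "a < b"
    and pos: "\<And>x. x \<in> S \<Longrightarrow> 0 < W x t" "\<And>x. x \<in> S \<Longrightarrow> 0 < W x u"
    and D: "\<And>x. x \<in> S \<Longrightarrow> ((\<lambda>x. ln (W x t)) has_real_derivative k x t) (at x within S)"
      "\<And>x. x \<in> S \<Longrightarrow> ((\<lambda>x. ln (W x u)) has_real_derivative k x u) (at x within S)"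
    and c: "c = 1 \<or> c = -1"
    and le: "\<And>x. x \<in> S \<Longrightarrow> 0 \<le> c * (k x u - k x t)"
  shows "0 \<le> c * (W b u / W a u - W b t / W a t)"
    and signed_ratio_less: "k a u \<noteq> k a t \<Longrightarrow> 0 < c * (W b u / W a u - W b t / W a t)"
proof -
  define h where "h x = c * (ln (W x u) - ln (W x t))" for x
  have Dh: "(h has_real_derivative c * (k x u - k x t)) (at x within S)" if "x \<in> S" for x
    unfolding h_def using D that by (intro DERIV_cmult DERIV_diff) auto
  have diff: "h b - h a = c * (ln (W b u / W a u) - ln (W b t / W a t))"
    using pos(1)[OF S(2)] pos(1)[OF S(3)] pos(2)[OF S(2)] pos(2)[OF S(3)]
    by (simp add: h_def ln_div algebra_simps)
  have ratio_pos: "0 < W b u / W a u" "0 < W b t / W a t"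
    using pos S by simp_all
  have "h a \<le> h b"
    using nonneg_derivative_within_imp_le[OF S(1-3) _ Dh le] S(4) by simp
  then show "0 \<le> c * (W b u / W a u - W b t / W a t)"
    using diff c ln_le_cancel_iff[OF ratio_pos] ln_le_cancel_iff[OF ratio_pos(2,1)] by auto
  show "0 < c * (W b u / W a u - W b t / W a t)" if "k a u \<noteq> k a t"
  proof -
    have "0 < c * (k a u - k a t)"
      using le[OF S(2)] that c by (auto simp: less_le)
    then have "h a < h b"
      using pos_derivative_within_imp_less[OF S Dh le] by simp
    then show ?thesis
      using diff c ln_less_cancel_iff[OF ratio_pos] ln_less_cancel_iff[OF ratio_pos(2,1)] by auto
  qed
qed

lemma equal_derivatives_imp_equal_increments:
  fixes f g :: "real \<Rightarrow> real"
  assumes S: "is_interval S" "a \<in> S" "b \<in> S" "a \<le> b"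
    and "\<And>x. x \<in> S \<Longrightarrow> (f has_real_derivative d x) (at x within S)"
    and "\<And>x. x \<in> S \<Longrightarrow> (g has_real_derivative d x) (at x within S)"
  shows "f b - f a = g b - g a"
proof (rule antisym)
  have "(\<lambda>x. g x - f x) a \<le> (\<lambda>x. g x - f x) b"
    by (rule nonneg_derivative_within_imp_le[OF S, where h' = "\<lambda>_. 0"])
      (use assms(5,6) in \<open>auto intro!: derivative_eq_intros\<close>)
  then show "f b - f a \<le> g b - g a" by simp
  have "(\<lambda>x. f x - g x) a \<le> (\<lambda>x. f x - g x) b"
    by (rule nonneg_derivative_within_imp_le[OF S, where h' = "\<lambda>_. 0"])
      (use assms(5,6) in \<open>auto intro!: derivative_eq_intros\<close>)
  then show "g b - g a \<le> f b - f a" by simp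
qed

section \<open>The laws of a weight family\<close>

lemma borel_measurable_mono_on_base:
  fixes f :: "real \<Rightarrow> real"
  assumes "base_measure J \<mu>" "mono_on J f"
  shows "f \<in> borel_measurable \<mu>"
  using assms(1) unfolding base_measure_def
proof (elim disjE conjE)
  assume "\<mu> = lebesgue_on J"
  moreover have "f \<in> borel_measurable (restrict_space borel J)"
    using borel_measurable_mono_on_fnc[OF assms(2)] .
  moreover have "measurable (restrict_space borel J) borel \<subseteq> measurable (lebesgue_on J) (borel :: real measure)"
  proof (rule measurable_mono)
    show "sets (restrict_space borel J) \<subseteq> sets (lebesgue_on J)"
      unfolding sets_restrict_space by (intro image_mono) (simp add: sets_completionI_sets subset_iff)
  qed (auto simp: space_restrict_space)
  ultimately show ?thesis by auto
qed auto

lemma borel_measurable_monotone_base: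
  fixes f :: "real \<Rightarrow> real"
  assumes "base_measure J \<mu>" "mono_on J f \<or> antimono_on J f"
  shows "f \<in> borel_measurable \<mu>"
proof (cases "mono_on J f")
  case True
  then show ?thesis using borel_measurable_mono_on_base assms by blast
next
  case False
  then have "mono_on J (\<lambda>t. - f t)"
    using assms(2) by (auto simp: monotone_on_def)
  then have "(\<lambda>t. - f t) \<in> borel_measurable \<mu>"
    using borel_measurable_mono_on_base assms(1) by blast
  then show ?thesis by simp
qed

context weight_family
begin

lemma space_base: "space \<mu> = J"
  using base by (auto simp: base_measure_def)

lemma space_law: "space (law \<mu> w x y) = J"
  by (simp add: law_def space_base)

lemma law_density_nonneg:
  "x \<in> Lam \<Longrightarrow> y \<in> Tht \<Longrightarrow> AE t in \<mu>. 0 \<le> w x y t / Phi \<mu> w x y"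
  using w_pos Phi_pos by (intro AE_I2) (auto simp: space_base less_imp_le)

lemma integrable_law_iff:
  fixes f :: "real \<Rightarrow> real"
  assumes "x \<in> Lam" "y \<in> Tht" "f \<in> borel_measurable \<mu>"
  shows "integrable (law \<mu> w x y) f \<longleftrightarrow> integrable \<mu> (\<lambda>t. w x y t * f t)"
proof -
  have "integrable (law \<mu> w x y) f \<longleftrightarrow> integrable \<mu> (\<lambda>t. w x y t * f t / Phi \<mu> w x y)"
    using assms w_measurable law_density_nonneg unfolding law_def
    by (subst integrable_density) auto
  also have "\<dots> \<longleftrightarrow> integrable \<mu> (\<lambda>t. w x y t * f t)"
    using Phi_pos[OF assms(1,2)]
      integrable_mult_right_iff[of \<mu> "\<lambda>t. w x y t * f t" "1 / Phi \<mu> w x y"] by simp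
  finally show ?thesis .
qed

lemma integral_law:
  fixes f :: "real \<Rightarrow> real"
  assumes "x \<in> Lam" "y \<in> Tht" "f \<in> borel_measurable \<mu>"
  shows "integral\<^sup>L (law \<mu> w x y) f = (\<integral>t. w x y t * f t \<partial>\<mu>) / Phi \<mu> w x y"
  using assms w_measurable law_density_nonneg unfolding law_def
  by (subst integral_density) auto

lemma prob_space_law:
  assumes "x \<in> Lam" "y \<in> Tht"
  shows "prob_space (law \<mu> w x y)"
proof
  have "emeasure (law \<mu> w x y) (space (law \<mu> w x y)) = (\<integral>\<^sup>+ t. ennreal (w x y t / Phi \<mu> w x y) \<partial>\<mu>)"
    using w_measurable[OF assms] by (simp add: law_def emeasure_density cong: nn_integral_cong)
  also have "\<dots> = ennreal (\<integral>t. w x y t / Phi \<mu> w x y \<partial>\<mu>)"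
    using w_integrable[OF assms] law_density_nonneg[OF assms]
    by (intro nn_integral_eq_integral) auto
  also have "\<dots> = 1"
    using Phi_pos[OF assms] by (simp add: Phi_def)
  finally show "emeasure (law \<mu> w x y) (space (law \<mu> w x y)) = 1" .
qed

text \<open>
  Multiplying the density of the law by a ratio of weights replaces the weight, so expectations of
  such ratios are ratios of values of \<open>Phi\<close>.
\<close>

lemma
  fixes f :: "real \<Rightarrow> real"
  assumes "x \<in> Lam" "y \<in> Tht" "x' \<in> Lam" "y' \<in> Tht"
    and f: "\<And>t. t \<in> J \<Longrightarrow> w x y t * f t = w x' y' t" and "f \<in> borel_measurable \<mu>"
  shows integrable_law_ratio: "integrable (law \<mu> w x y) f"
    and integral_law_ratio: "integral\<^sup>L (law \<mu> w x y) f = Phi \<mu> w x' y' / Phi \<mu> w x y"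
proof -
  have "integrable \<mu> (\<lambda>t. w x y t * f t) \<longleftrightarrow> integrable \<mu> (w x' y')"
    using f by (intro Bochner_Integration.integrable_cong) (auto simp: space_base)
  then show "integrable (law \<mu> w x y) f"
    using assms integrable_law_iff w_integrable by simp
  have "(\<integral>t. w x y t * f t \<partial>\<mu>) = Phi \<mu> w x' y'"
    unfolding Phi_def using f by (intro Bochner_Integration.integral_cong) (auto simp: space_base)
  then show "integral\<^sup>L (law \<mu> w x y) f = Phi \<mu> w x' y' / Phi \<mu> w x y"
    using assms integral_law by simp
qed

lemma Phi_difference_eq_covariance:
  assumes x: "x1 \<in> Lam" "x2 \<in> Lam" and y: "y1 \<in> Tht" "y2 \<in> Tht"
    and fact: "\<And>t. t \<in> J \<Longrightarrow> w x2 y2 t * w x1 y1 t = w x2 y1 t * w x1 y2 t"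
  defines "r \<equiv> \<lambda>t. w x2 y1 t / w x1 y1 t" and "s \<equiv> \<lambda>t. w x1 y2 t / w x1 y1 t"
  shows "integrable (law \<mu> w x1 y1) r" "integrable (law \<mu> w x1 y1) s"
    and "integrable (law \<mu> w x1 y1) (\<lambda>t. r t * s t)"
    and "Phi \<mu> w x2 y2 * Phi \<mu> w x1 y1 - Phi \<mu> w x1 y2 * Phi \<mu> w x2 y1
      = (Phi \<mu> w x1 y1)\<^sup>2 * covariance (law \<mu> w x1 y1) r s"
proof -
  interpret Q: prob_space "law \<mu> w x1 y1"
    using prob_space_law x y by simp
  have [measurable]: "w x1 y1 \<in> borel_measurable \<mu>" "w x2 y1 \<in> borel_measurable \<mu>"
    "w x1 y2 \<in> borel_measurable \<mu>"
    using x y w_measurable by auto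
  have meas: "r \<in> borel_measurable \<mu>" "s \<in> borel_measurable \<mu>" "(\<lambda>t. r t * s t) \<in> borel_measurable \<mu>"
    unfolding r_def s_def by measurable
  have ratio: "w x1 y1 t * r t = w x2 y1 t" "w x1 y1 t * s t = w x1 y2 t"
    "w x1 y1 t * (r t * s t) = w x2 y2 t" if "t \<in> J" for t
    using w_pos[OF x(1) y(1) that] fact[OF that] by (auto simp: r_def s_def field_simps)
  note r = integrable_law_ratio[OF x(1) y(1) x(2) y(1) ratio(1) meas(1)]
    integral_law_ratio[OF x(1) y(1) x(2) y(1) ratio(1) meas(1)]
  note s = integrable_law_ratio[OF x(1) y(1) x(1) y(2) ratio(2) meas(2)]
    integral_law_ratio[OF x(1) y(1) x(1) y(2) ratio(2) meas(2)]
  note rs = integrable_law_ratio[OF x(1) y(1) x(2) y(2) ratio(3) meas(3)]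
    integral_law_ratio[OF x(1) y(1) x(2) y(2) ratio(3) meas(3)]
  show int: "integrable (law \<mu> w x1 y1) r" "integrable (law \<mu> w x1 y1) s"
    "integrable (law \<mu> w x1 y1) (\<lambda>t. r t * s t)"
    using r(1) s(1) rs(1) by auto
  show "Phi \<mu> w x2 y2 * Phi \<mu> w x1 y1 - Phi \<mu> w x1 y2 * Phi \<mu> w x2 y1
      = (Phi \<mu> w x1 y1)\<^sup>2 * covariance (law \<mu> w x1 y1) r s"
    using Phi_pos[OF x(1) y(1)]
    by (simp add: Q.covariance_eq[OF int] r(2) s(2) rs(2) power2_eq_square field_simps)
qed

end

context regular_weight_family
begin

lemma has_derivative_kernelK:
  assumes "x \<in> Lam" "y \<in> Tht" "t \<in> J"
  shows "((\<lambda>x. ln (w x y t)) has_real_derivative kernelK Lam w x y t) (at x within Lam)"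
  unfolding kernelK_def partial1_def
  using C1_Lam[OF assms(2,3)] assms(1) by (intro deriv_within_works) (auto simp: C1_on_def)

lemma has_derivative_kernelL:
  assumes "x \<in> Lam" "y \<in> Tht" "t \<in> J"
  shows "((\<lambda>y. ln (w x y t)) has_real_derivative kernelL Tht w x y t) (at y within Tht)"
  unfolding kernelL_def partial2_def
  using C1_Tht[OF assms(1,3)] assms(2) by (intro deriv_within_works) (auto simp: C1_on_def)

text \<open>
  The derivative of the weight is the weight times its logarithmic derivative, so the domination of
  the former on a one-point interval says that the kernel is integrable under the law.  The second
  point of the interval makes derivatives within it unique.
\<close>

lemma integrable_law_kernelK:
  assumes S: "a \<in> Lam" "b \<in> Lam" "a \<noteq> b" and x: "x \<in> Lam" and y: "y \<in> Tht"
    and mono: "mono_on J (kernelK Lam w x y) \<or> antimono_on J (kernelK Lam w x y)"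
  shows "integrable (law \<mu> w x y) (kernelK Lam w x y)"
proof -
  have meas: "kernelK Lam w x y \<in> borel_measurable \<mu>"
    using borel_measurable_monotone_base[OF base mono] .
  obtain m where m: "integrable \<mu> m"
      and bound: "AE t in \<mu>. \<forall>x\<in>{x..x}. \<bar>partial1 Lam (\<lambda>u v. w u v t) x y\<bar> \<le> m t"
    using dominated_Lam[of y x x] x y by auto
  have eq: "partial1 Lam (\<lambda>u v. w u v t) x y = w x y t * kernelK Lam w x y t" if "t \<in> J" for t
    unfolding partial1_def
    using deriv_within_weight[OF interval_Lam S x w_pos[OF _ y that] has_derivative_kernelK[OF x y that]]
    by simp
  have "AE t in \<mu>. norm (w x y t * kernelK Lam w x y t) \<le> norm (m t)"
    using bound AE_space by eventually_elim (use eq in \<open>auto simp: space_base\<close>)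
  then have "integrable \<mu> (\<lambda>t. w x y t * kernelK Lam w x y t)"
    using m meas w_measurable[OF x y] by (intro Bochner_Integration.integrable_bound[OF m]) auto
  then show ?thesis
    using integrable_law_iff[OF x y meas] by simp
qed

lemma integrable_law_kernelL:
  assumes S: "a \<in> Tht" "b \<in> Tht" "a \<noteq> b" and x: "x \<in> Lam" and y: "y \<in> Tht"
    and mono: "mono_on J (kernelL Tht w x y) \<or> antimono_on J (kernelL Tht w x y)"
  shows "integrable (law \<mu> w x y) (kernelL Tht w x y)"
proof -
  have meas: "kernelL Tht w x y \<in> borel_measurable \<mu>"
    using borel_measurable_monotone_base[OF base mono] .
  obtain m where m: "integrable \<mu> m"
      and bound: "AE t in \<mu>. \<forall>y\<in>{y..y}. \<bar>partial2 Tht (\<lambda>u v. w u v t) x y\<bar> \<le> m t"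
    using dominated_Tht[of x y y] x y by auto
  have eq: "partial2 Tht (\<lambda>u v. w u v t) x y = w x y t * kernelL Tht w x y t" if "t \<in> J" for t
    unfolding partial2_def
    using deriv_within_weight[OF interval_Tht S y w_pos[OF x _ that] has_derivative_kernelL[OF x y that]]
    by simp
  have "AE t in \<mu>. norm (w x y t * kernelL Tht w x y t) \<le> norm (m t)"
    using bound AE_space by eventually_elim (use eq in \<open>auto simp: space_base\<close>)
  then have "integrable \<mu> (\<lambda>t. w x y t * kernelL Tht w x y t)"
    using m meas w_measurable[OF x y] by (intro Bochner_Integration.integrable_bound[OF m]) auto
  then show ?thesis
    using integrable_law_iff[OF x y meas] by simp
qed

lemma weights_factorize:
  assumes indep: "\<forall>x\<in>Lam. \<forall>y\<in>Tht. \<forall>y'\<in>Tht. \<forall>t\<in>J. kernelK Lam w x y t = kernelK Lam w x y' t"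
    and x: "x1 \<in> Lam" "x2 \<in> Lam" "x1 \<le> x2" and y: "y1 \<in> Tht" "y2 \<in> Tht" and t: "t \<in> J"
  shows "w x2 y2 t * w x1 y1 t = w x2 y1 t * w x1 y2 t"
proof -
  have "ln (w x2 y2 t) - ln (w x1 y2 t) = ln (w x2 y1 t) - ln (w x1 y1 t)"
  proof (rule equal_derivatives_imp_equal_increments[OF interval_Lam x])
    show "((\<lambda>x. ln (w x y1 t)) has_real_derivative kernelK Lam w x y1 t) (at x within Lam)"
      if "x \<in> Lam" for x
      using has_derivative_kernelK that y t by blast
    show "((\<lambda>x. ln (w x y2 t)) has_real_derivative kernelK Lam w x y1 t) (at x within Lam)"
      if "x \<in> Lam" for x
    proof -
      have "kernelK Lam w x y1 t = kernelK Lam w x y2 t"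
        using indep that y t by blast
      then show ?thesis
        using has_derivative_kernelK[OF that y(2) t] by (simp only:)
    qed
  qed
  moreover have pos: "0 < w x2 y2 t" "0 < w x1 y1 t" "0 < w x2 y1 t" "0 < w x1 y2 t"
    using w_pos x y t by blast+
  ultimately have "ln (w x2 y2 t * w x1 y1 t) = ln (w x2 y1 t * w x1 y2 t)"
    by (simp add: ln_mult_pos)
  then show ?thesis
    using pos by (subst (asm) ln_inj_iff) simp_all
qed

end

lemma mono_sign_increment_nonneg:
  assumes "mono_sign J f c" "t \<in> J" "u \<in> J" "t \<le> u"
  shows "0 \<le> c * (f u - f t)"
  using assms by (auto simp: mono_sign_def monotone_on_def)

text \<open>
  The hypotheses of Chebyshev's inequality are symmetric in the two points, so they follow from
  their versions for ordered pairs, which is what monotonicity provides.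
\<close>

lemma
  fixes r s k l :: "real \<Rightarrow> real"
  assumes r: "\<And>t u. t \<in> J \<Longrightarrow> u \<in> J \<Longrightarrow> t \<le> u \<Longrightarrow> 0 \<le> c * (r u - r t)"
      "\<And>t u. t \<in> J \<Longrightarrow> u \<in> J \<Longrightarrow> t \<le> u \<Longrightarrow> k u \<noteq> k t \<Longrightarrow> 0 < c * (r u - r t)"
    and s: "\<And>t u. t \<in> J \<Longrightarrow> u \<in> J \<Longrightarrow> t \<le> u \<Longrightarrow> 0 \<le> d * (s u - s t)"
      "\<And>t u. t \<in> J \<Longrightarrow> u \<in> J \<Longrightarrow> t \<le> u \<Longrightarrow> l u \<noteq> l t \<Longrightarrow> 0 < d * (s u - s t)"
    and tu: "t \<in> J" "u \<in> J"
  shows signed_increment_product_nonneg: "0 \<le> c * d * ((r t - r u) * (s t - s u))"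
    and signed_increment_product_separates: "(r t - r u) * (s t - s u) = 0 \<Longrightarrow> (k t - k u) * (l t - l u) = 0"
proof -
  have swap: "c * d * ((r t - r u) * (s t - s u)) = (c * (r t - r u)) * (d * (s t - s u))"
    "c * d * ((r t - r u) * (s t - s u)) = (c * (r u - r t)) * (d * (s u - s t))"
    by (simp_all add: algebra_simps)
  show "0 \<le> c * d * ((r t - r u) * (s t - s u))"
  proof (cases "t \<le> u")
    case True
    then show ?thesis
      unfolding swap(2) using r(1)[OF tu] s(1)[OF tu] by simp
  next
    case False
    then show ?thesis
      unfolding swap(1) using r(1)[OF tu(2,1)] s(1)[OF tu(2,1)] by simp
  qed
  show "(k t - k u) * (l t - l u) = 0" if zero: "(r t - r u) * (s t - s u) = 0"
  proof -
    from zero have "r t = r u \<or> s t = s u" by simp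
    then have "k t = k u \<or> l t = l u"
      using r(2)[of t u] r(2)[of u t] s(2)[of t u] s(2)[of u t] tu linear[of t u] by force
    then show ?thesis by auto
  qed
qed

section \<open>Log-supermodularity\<close>

context regular_weight_family
begin

lemma Phi_difference_signed:
  assumes indep: "\<forall>x\<in>Lam. \<forall>y\<in>Tht. \<forall>y'\<in>Tht. \<forall>t\<in>J. kernelK Lam w x y t = kernelK Lam w x y' t"
    and K: "\<forall>x\<in>Lam. \<forall>y\<in>Tht. mono_sign J (kernelK Lam w x y) c"
    and L: "\<forall>x\<in>Lam. \<forall>y\<in>Tht. mono_sign J (kernelL Tht w x y) d"
    and cd: "c * d \<noteq> 0"
    and x: "x1 \<in> Lam" "x2 \<in> Lam" "x1 < x2" and y: "y1 \<in> Tht" "y2 \<in> Tht" "y1 < y2"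
  shows "0 \<le> c * d * (Phi \<mu> w x2 y2 * Phi \<mu> w x1 y1 - Phi \<mu> w x1 y2 * Phi \<mu> w x2 y1)"
    and "covariance (law \<mu> w x1 y1) (kernelK Lam w x1 y1) (kernelL Tht w x1 y1) \<noteq> 0 \<Longrightarrow>
      0 < c * d * (Phi \<mu> w x2 y2 * Phi \<mu> w x1 y1 - Phi \<mu> w x1 y2 * Phi \<mu> w x2 y1)"
proof -
  interpret Q: prob_space "law \<mu> w x1 y1"
    using prob_space_law x y by simp
  define r where "r t = w x2 y1 t / w x1 y1 t" for t
  define s where "s t = w x1 y2 t / w x1 y1 t" for t
  have K1: "mono_sign J (kernelK Lam w x1 y1) c" and L1: "mono_sign J (kernelL Tht w x1 y1) d"
    using K L x(1) y(1) by blast+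
  have c: "c = 1 \<or> c = -1" and d: "d = 1 \<or> d = -1"
    using K1 L1 cd unfolding mono_sign_def by auto
  have r: "0 \<le> c * (r u - r t)" "kernelK Lam w x1 y1 u \<noteq> kernelK Lam w x1 y1 t \<Longrightarrow> 0 < c * (r u - r t)"
    if "t \<in> J" "u \<in> J" "t \<le> u" for t u
  proof -
    have le: "0 \<le> c * (kernelK Lam w x y1 u - kernelK Lam w x y1 t)" if "x \<in> Lam" for x
      using K that y(1)
      by (intro mono_sign_increment_nonneg[OF _ \<open>t \<in> J\<close> \<open>u \<in> J\<close> \<open>t \<le> u\<close>]) auto
    note * = interval_Lam x w_pos[OF _ y(1) that(1)] w_pos[OF _ y(1) that(2)]
      has_derivative_kernelK[OF _ y(1) that(1)] has_derivative_kernelK[OF _ y(1) that(2)] c le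
    show "0 \<le> c * (r u - r t)"
      unfolding r_def
      by (rule signed_ratio_le[where S = Lam and a = x1 and b = x2 and t = t and u = u and
          W = "\<lambda>x. w x y1" and k = "\<lambda>x. kernelK Lam w x y1"]) (assumption | rule *)+
    show "0 < c * (r u - r t)" if "kernelK Lam w x1 y1 u \<noteq> kernelK Lam w x1 y1 t"
      unfolding r_def
      by (rule signed_ratio_less[where S = Lam and a = x1 and b = x2 and t = t and u = u and
          W = "\<lambda>x. w x y1" and k = "\<lambda>x. kernelK Lam w x y1"]) (assumption | rule * that)+
  qed
  have s: "0 \<le> d * (s u - s t)" "kernelL Tht w x1 y1 u \<noteq> kernelL Tht w x1 y1 t \<Longrightarrow> 0 < d * (s u - s t)"
    if "t \<in> J" "u \<in> J" "t \<le> u" for t u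
  proof -
    have le: "0 \<le> d * (kernelL Tht w x1 y u - kernelL Tht w x1 y t)" if "y \<in> Tht" for y
      using L that x(1)
      by (intro mono_sign_increment_nonneg[OF _ \<open>t \<in> J\<close> \<open>u \<in> J\<close> \<open>t \<le> u\<close>]) auto
    note * = interval_Tht y w_pos[OF x(1) _ that(1)] w_pos[OF x(1) _ that(2)]
      has_derivative_kernelL[OF x(1) _ that(1)] has_derivative_kernelL[OF x(1) _ that(2)] d le
    show "0 \<le> d * (s u - s t)"
      unfolding s_def
      by (rule signed_ratio_le[where S = Tht and a = y1 and b = y2 and t = t and u = u and
          W = "w x1" and k = "kernelL Tht w x1"]) (assumption | rule *)+
    show "0 < d * (s u - s t)" if "kernelL Tht w x1 y1 u \<noteq> kernelL Tht w x1 y1 t"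
      unfolding s_def
      by (rule signed_ratio_less[where S = Tht and a = y1 and b = y2 and t = t and u = u and
          W = "w x1" and k = "kernelL Tht w x1"]) (assumption | rule * that)+
  qed
  have fact: "w x2 y2 t * w x1 y1 t = w x2 y1 t * w x1 y2 t" if "t \<in> J" for t
    using weights_factorize[OF indep x(1,2) less_imp_le[OF x(3)] y(1,2) that] .
  have cov: "integrable (law \<mu> w x1 y1) r" "integrable (law \<mu> w x1 y1) s"
      "integrable (law \<mu> w x1 y1) (\<lambda>t. r t * s t)"
      "Phi \<mu> w x2 y2 * Phi \<mu> w x1 y1 - Phi \<mu> w x1 y2 * Phi \<mu> w x2 y1
        = (Phi \<mu> w x1 y1)\<^sup>2 * covariance (law \<mu> w x1 y1) r s"
    unfolding r_def s_def
    using Phi_difference_eq_covariance[where ?x1.0 = x1 and ?x2.0 = x2 and ?y1.0 = y1 and ?y2.0 = y2]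
      x y fact by simp_all
  have sign: "0 \<le> c * d * ((r t - r u) * (s t - s u))"
    if "t \<in> space (law \<mu> w x1 y1)" "u \<in> space (law \<mu> w x1 y1)" for t u
    by (rule signed_increment_product_nonneg[where J = J and c = c and r = r and d = d and s = s
          and k = "kernelK Lam w x1 y1" and l = "kernelL Tht w x1 y1", OF r s that[unfolded space_law]])
  have sep: "(kernelK Lam w x1 y1 t - kernelK Lam w x1 y1 u)
      * (kernelL Tht w x1 y1 t - kernelL Tht w x1 y1 u) = 0"
    if "t \<in> space (law \<mu> w x1 y1)" "u \<in> space (law \<mu> w x1 y1)"
      "(r t - r u) * (s t - s u) = 0" for t u
    by (rule signed_increment_product_separates[where J = J and c = c and r = r and d = d and s = s
          and k = "kernelK Lam w x1 y1" and l = "kernelL Tht w x1 y1", OF r s that[unfolded space_law]])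
  have diff: "c * d * (Phi \<mu> w x2 y2 * Phi \<mu> w x1 y1 - Phi \<mu> w x1 y2 * Phi \<mu> w x2 y1)
      = (Phi \<mu> w x1 y1)\<^sup>2 * (c * d * covariance (law \<mu> w x1 y1) r s)"
    unfolding cov(4) by simp
  show "0 \<le> c * d * (Phi \<mu> w x2 y2 * Phi \<mu> w x1 y1 - Phi \<mu> w x1 y2 * Phi \<mu> w x2 y1)"
    unfolding diff using Q.covariance_nonneg[OF cov(1-3) sign] by simp
  assume nz: "covariance (law \<mu> w x1 y1) (kernelK Lam w x1 y1) (kernelL Tht w x1 y1) \<noteq> 0"
  have "mono_on J (kernelK Lam w x1 y1) \<or> antimono_on J (kernelK Lam w x1 y1)"
    "mono_on J (kernelL Tht w x1 y1) \<or> antimono_on J (kernelL Tht w x1 y1)"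
    using K1 L1 cd unfolding mono_sign_def by auto
  then have kl: "integrable (law \<mu> w x1 y1) (kernelK Lam w x1 y1)"
    "integrable (law \<mu> w x1 y1) (kernelL Tht w x1 y1)"
    using integrable_law_kernelK[OF x(1,2) _ x(1) y(1)] integrable_law_kernelL[OF y(1,2) _ x(1) y(1)]
      x(3) y(3) by auto
  have "0 < c * d * covariance (law \<mu> w x1 y1) r s"
    by (rule Q.covariance_pos[OF cov(1-3) sign kl sep nz cd])
  then show "0 < c * d * (Phi \<mu> w x2 y2 * Phi \<mu> w x1 y1 - Phi \<mu> w x1 y2 * Phi \<mu> w x2 y1)"
    unfolding diff using Phi_pos[OF x(1) y(1)] by simp
qed

end

theorem corollary2p19:
  fixes Lam Tht J :: "real set"
    and \<mu> :: "real measure"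
    and w :: "real \<Rightarrow> real \<Rightarrow> real \<Rightarrow> real"
    and \<epsilon>K \<epsilon>L :: real
  assumes family: "regular_weight_family Lam Tht J \<mu> w"
    and K_indep: "\<forall>x\<in>Lam. \<forall>y\<in>Tht. \<forall>y'\<in>Tht. \<forall>t\<in>J. kernelK Lam w x y t = kernelK Lam w x y' t"
    and K_mono: "\<forall>x\<in>Lam. \<forall>y\<in>Tht.
      (mono_on J (kernelK Lam w x y) \<or> antimono_on J (kernelK Lam w x y)) \<and>
      mono_sign J (kernelK Lam w x y) \<epsilon>K"
    and L_mono: "\<forall>x\<in>Lam. \<forall>y\<in>Tht.
      (mono_on J (kernelL Tht w x y) \<or> antimono_on J (kernelL Tht w x y)) \<and>
      mono_sign J (kernelL Tht w x y) \<epsilon>L"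
  shows "(\<forall>\<xi>1\<in>Lam. \<forall>\<xi>2\<in>Lam. \<forall>\<eta>1\<in>Tht. \<forall>\<eta>2\<in>Tht. \<xi>1 \<le> \<xi>2 \<longrightarrow> \<eta>1 \<le> \<eta>2 \<longrightarrow>
           \<epsilon>K * \<epsilon>L * (Phi \<mu> w \<xi>2 \<eta>2 * Phi \<mu> w \<xi>1 \<eta>1 - Phi \<mu> w \<xi>1 \<eta>2 * Phi \<mu> w \<xi>2 \<eta>1) \<ge> 0) \<and>
         (\<epsilon>K * \<epsilon>L = 1 \<longrightarrow> log_supermodular_on Lam Tht (Phi \<mu> w)) \<and>
         (\<epsilon>K * \<epsilon>L = -1 \<longrightarrow> log_submodular_on Lam Tht (Phi \<mu> w)) \<and>
         (\<forall>\<xi>1\<in>Lam. \<forall>\<xi>2\<in>Lam. \<forall>\<eta>1\<in>Tht. \<forall>\<eta>2\<in>Tht. \<xi>1 < \<xi>2 \<longrightarrow> \<eta>1 < \<eta>2 \<longrightarrow>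
           (\<forall>x\<in>{\<xi>1..\<xi>2}. \<forall>y\<in>{\<eta>1..\<eta>2}.
              \<epsilon>K * \<epsilon>L * covariance (law \<mu> w x y) (kernelK Lam w x y) (kernelL Tht w x y) > 0) \<longrightarrow>
           \<epsilon>K * \<epsilon>L * (Phi \<mu> w \<xi>2 \<eta>2 * Phi \<mu> w \<xi>1 \<eta>1 - Phi \<mu> w \<xi>1 \<eta>2 * Phi \<mu> w \<xi>2 \<eta>1) > 0)"
proof -
  interpret regular_weight_family Lam Tht J \<mu> w
    using family .
  have signs: "\<forall>x\<in>Lam. \<forall>y\<in>Tht. mono_sign J (kernelK Lam w x y) \<epsilon>K"
    "\<forall>x\<in>Lam. \<forall>y\<in>Tht. mono_sign J (kernelL Tht w x y) \<epsilon>L"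
    using K_mono L_mono by auto
  have weak: "0 \<le> \<epsilon>K * \<epsilon>L * (Phi \<mu> w x2 y2 * Phi \<mu> w x1 y1 - Phi \<mu> w x1 y2 * Phi \<mu> w x2 y1)"
    if "x1 \<in> Lam" "x2 \<in> Lam" "y1 \<in> Tht" "y2 \<in> Tht" "x1 \<le> x2" "y1 \<le> y2" for x1 x2 y1 y2
  proof (cases "\<epsilon>K * \<epsilon>L = 0 \<or> x1 = x2 \<or> y1 = y2")
    case True
    then show ?thesis by auto
  next
    case False
    then show ?thesis
      using Phi_difference_signed(1)[OF K_indep signs] that by simp
  qed
  have strict: "0 < \<epsilon>K * \<epsilon>L * (Phi \<mu> w x2 y2 * Phi \<mu> w x1 y1 - Phi \<mu> w x1 y2 * Phi \<mu> w x2 y1)"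
    if x: "x1 \<in> Lam" "x2 \<in> Lam" "x1 < x2" and y: "y1 \<in> Tht" "y2 \<in> Tht" "y1 < y2"
      and cov: "\<forall>x\<in>{x1..x2}. \<forall>y\<in>{y1..y2}.
        \<epsilon>K * \<epsilon>L * covariance (law \<mu> w x y) (kernelK Lam w x y) (kernelL Tht w x y) > 0"
    for x1 x2 y1 y2
  proof -
    have corner: "\<epsilon>K * \<epsilon>L * covariance (law \<mu> w x1 y1) (kernelK Lam w x1 y1) (kernelL Tht w x1 y1) > 0"
      using cov x(3) y(3) by simp
    then have "\<epsilon>K * \<epsilon>L \<noteq> 0"
      "covariance (law \<mu> w x1 y1) (kernelK Lam w x1 y1) (kernelL Tht w x1 y1) \<noteq> 0"
      by auto
    then show ?thesis
      using Phi_difference_signed(2)[OF K_indep signs _ x y] by simp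
  qed
  have "log_supermodular_on Lam Tht (Phi \<mu> w)" if "\<epsilon>K * \<epsilon>L = 1"
    using weak unfolding that log_supermodular_on_def by auto
  moreover have "log_submodular_on Lam Tht (Phi \<mu> w)" if "\<epsilon>K * \<epsilon>L = -1"
    using weak unfolding that log_submodular_on_def by auto
  ultimately show ?thesis
    by (intro conjI ballI impI) (simp_all add: weak strict)
qed

end
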